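(* Let $d\ge 2$, let $k$ be an algebraically closed field whose characteristic does not divide $d!$, and let $R$ be the ring of components associated to the symmetric group $G=\mathfrak{S}_d$, the set $D=\{c\}$ where $c$ is the conjugacy class of transpositions, and $\xi(c)=1$. Then the set $(\operatorname{Spec}R)(k)$ of $k$-points of $\operatorname{Spec}R$, seen as a subset of $k^{d(d-1)/2}$, is the union of the vector spaces $\operatorname{Span}_k(e_{A_1},\dots,e_{A_s})$ over (maximal) families $\{A_1,\dots,A_s\}$ of disjoint subsets of $\{1,\dots,d\}$.
   Context: The Artin braid group $\mathrm{B}_n$ (standard generators $\sigma_1,\dots,\sigma_{n-1}$) acts on $G^n$ by the Hurwitz action: $\sigma_i$ replaces the entries $(g_i,g_{i+1})$ in positions $i,i+1$ by $(g_ig_{i+1}g_i^{-1},g_i)$ and fixes the other entries. For $G=\mathfrak{S}_d$, $D=\{c\}$, $\xi(c)=1$, a component of degree $n$ is an orbit, under $\mathrm{B}_n$, of a tuple $(g_1,\dots,g_n)$ of transpositions in $\mathfrak{S}_d$ with $g_1\cdots g_n=1$. Components of all degrees $n\ge 0$ form, under concatenation, a commutative finitely generated graded monoid $\mathrm{Comp}$, with identity the orbit of the empty tuple (the trivial component). The ring of components is the monoid ring $R=k[\mathrm{Comp}]$. A nontrivial component is non-factorizable if it is not a product of two nontrivial components. Here the non-factorizable components are the $d(d-1)/2$ orbits $p_{i,j}$ of the pairs $(\tau,\tau)$ with $\tau=(i\ j)$, $1\le i<j\le d$; they generate $\mathrm{Comp}$. A $k$-point of $\operatorname{Spec}R$ is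 a $k$-algebra morphism $\varphi:R\to k$; it is identified with the point $(\varphi(p_{i,j}))_{1\le i<j\le d}$ of $k^{d(d-1)/2}$. Let $(e_{i,j})_{1\le i<j\le d}$ be the standard basis of $k^{d(d-1)/2}$, and for $A\subseteq\{1,\dots,d\}$ put $$e_A=\sum_{\substack{1\le i<j\le d\\ i,j\in A}}e_{i,j}.$$ *)

theory Defs
  imports
    "HOL-Algebra.Group_Action"
    "HOL-Algebra.Sym_Groups"
    "HOL-Algebra.Algebraic_Closure_Type"
    "HOL-Library.Function_Algebras"
    "HOL-Library.Disjoint_Sets"
begin

section \<open>Artin braid groups\<close>

text \<open>
  The braid group on \<open>n\<close> strands is given by its Artin presentation. A word is a list of letters
  \<open>(i, s)\<close> with \<open>1 \<le> i \<le> n - 1\<close>; the letter \<open>(i, True)\<close> stands for the generator \<open>\<sigma>\<^sub>i\<close> and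
  \<open>(i, False)\<close> for its inverse.
\<close>

type_synonym braid_word = "(nat \<times> bool) list"

definition braid_words :: "nat \<Rightarrow> braid_word set"
  where "braid_words n = lists ({1..<n} \<times> UNIV)"

inductive_set braid_eq :: "nat \<Rightarrow> (braid_word \<times> braid_word) set" for n :: nat
  where
    refl: "w \<in> braid_words n \<Longrightarrow> (w, w) \<in> braid_eq n"
  | sym: "(v, w) \<in> braid_eq n \<Longrightarrow> (w, v) \<in> braid_eq n"
  | trans: "(u, v) \<in> braid_eq n \<Longrightarrow> (v, w) \<in> braid_eq n \<Longrightarrow> (u, w) \<in> braid_eq n"
  | congr: "(v, w) \<in> braid_eq n \<Longrightarrow> a \<in> braid_words n \<Longrightarrow> b \<in> braid_words n
      \<Longrightarrow> (a @ v @ b, a @ w @ b) \<in> braid_eq n"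
  | cancel: "i \<in> {1..<n} \<Longrightarrow> ([(i, s), (i, \<not> s)], []) \<in> braid_eq n"
  | far: "i \<in> {1..<n} \<Longrightarrow> j \<in> {1..<n} \<Longrightarrow> i + 2 \<le> j
      \<Longrightarrow> ([(i, True), (j, True)], [(j, True), (i, True)]) \<in> braid_eq n"
  | braid: "i \<in> {1..<n} \<Longrightarrow> i + 1 \<in> {1..<n}
      \<Longrightarrow> ([(i, True), (i + 1, True), (i, True)], [(i + 1, True), (i, True), (i + 1, True)])
          \<in> braid_eq n"

definition braid_group :: "nat \<Rightarrow> braid_word set monoid"
  where "braid_group n =
    \<lparr> carrier = braid_words n // braid_eq n,
      monoid.mult = (\<lambda>x y. \<Union>v\<in>x. \<Union>w\<in>y. braid_eq n `` {v @ w}),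
      one = braid_eq n `` {[]} \<rparr>"

lemma braid_words_simps [simp]:
  "[] \<in> braid_words n"
  "a # w \<in> braid_words n \<longleftrightarrow> fst a \<in> {1..<n} \<and> w \<in> braid_words n"
  "v @ w \<in> braid_words n \<longleftrightarrow> v \<in> braid_words n \<and> w \<in> braid_words n"
  by (auto simp: braid_words_def mem_Times_iff)

lemma braid_eq_words: "(v, w) \<in> braid_eq n \<Longrightarrow> v \<in> braid_words n \<and> w \<in> braid_words n"
  by (induction rule: braid_eq.induct) auto

lemma equiv_braid_eq: "equiv (braid_words n) (braid_eq n)"
proof (rule equivI)
  show "braid_eq n \<subseteq> braid_words n \<times> braid_words n"
    using braid_eq_words by fast
  show "refl_on (braid_words n) (braid_eq n)"
    by (rule refl_onI) (rule braid_eq.refl)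
  show "sym (braid_eq n)"
    by (rule symI) (rule braid_eq.sym)
  show "trans (braid_eq n)"
    by (rule transI) (rule braid_eq.trans)
qed

lemma braid_eq_append:
  assumes "(v, v') \<in> braid_eq n" "(w, w') \<in> braid_eq n"
  shows "(v @ w, v' @ w') \<in> braid_eq n"
proof -
  have "(v @ w, v' @ w) \<in> braid_eq n"
    using braid_eq.congr[OF assms(1), of "[]" w] braid_eq_words[OF assms(2)] by simp
  moreover have "(v' @ w, v' @ w') \<in> braid_eq n"
    using braid_eq.congr[OF assms(2), of v' "[]"] braid_eq_words[OF assms(1)] by simp
  ultimately show ?thesis by (rule braid_eq.trans)
qed

lemma braid_mult_class:
  assumes "v \<in> braid_words n" "w \<in> braid_words n"
  shows "braid_eq n `` {v} \<otimes>\<^bsub>braid_group n\<^esub> braid_eq n `` {w} = braid_eq n `` {v @ w}"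
proof -
  have "congruent2 (braid_eq n) (braid_eq n) (\<lambda>v w. braid_eq n `` {v @ w})"
    by (rule congruent2I')
      (metis braid_eq_append equiv_braid_eq equiv_class_eq)
  from UN_equiv_class2[OF equiv_braid_eq equiv_braid_eq this assms]
  show ?thesis by (simp add: braid_group_def)
qed

lemma braid_carrierE:
  assumes "x \<in> carrier (braid_group n)"
  obtains w where "w \<in> braid_words n" "x = braid_eq n `` {w}"
  using assms by (auto simp: braid_group_def elim: quotientE)

lemma braid_class_carrier: "w \<in> braid_words n \<Longrightarrow> braid_eq n `` {w} \<in> carrier (braid_group n)"
  by (simp add: braid_group_def quotientI)

lemma braid_left_inverse:
  assumes "w \<in> braid_words n"
  shows "\<exists>v \<in> braid_words n. (v @ w, []) \<in> braid_eq n"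
  using assms
proof (induction w)
  case Nil
  then show ?case by (intro bexI[of _ "[]"]) (auto intro: braid_eq.refl)
next
  case (Cons a w)
  obtain i s where a: "a = (i, s)" by fastforce
  from Cons obtain v where v: "v \<in> braid_words n" "(v @ w, []) \<in> braid_eq n" by auto
  have "([(i, \<not> s), (i, s)], []) \<in> braid_eq n"
    using braid_eq.cancel[of i n "\<not> s"] Cons.prems a by simp
  from braid_eq.congr[OF this v(1), of w] have "(v @ [(i, \<not> s), (i, s)] @ w, v @ w) \<in> braid_eq n"
    using Cons.prems by simp
  from braid_eq.trans[OF this v(2)] show ?case
    using v(1) Cons.prems a by (intro bexI[of _ "v @ [(i, \<not> s)]"]) auto
qed

lemma group_braid_group: "group (braid_group n)"
proof (rule groupI)
  show "\<one>\<^bsub>braid_group n\<^esub> \<in> carrier (braid_group n)"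
    by (simp add: braid_group_def quotientI)
next
  fix x assume "x \<in> carrier (braid_group n)"
  then obtain w where w: "w \<in> braid_words n" "x = braid_eq n `` {w}" by (rule braid_carrierE)
  have one: "\<one>\<^bsub>braid_group n\<^esub> = braid_eq n `` {[]}" by (simp add: braid_group_def)
  show "\<one>\<^bsub>braid_group n\<^esub> \<otimes>\<^bsub>braid_group n\<^esub> x = x"
    unfolding one w(2) using w(1) by (subst braid_mult_class) auto
  obtain v where v: "v \<in> braid_words n" "(v @ w, []) \<in> braid_eq n"
    using braid_left_inverse[OF w(1)] by blast
  show "\<exists>y\<in>carrier (braid_group n). y \<otimes>\<^bsub>braid_group n\<^esub> x = \<one>\<^bsub>braid_group n\<^esub>"
    unfolding one w(2) using v w(1)
    by (intro bexI[of _ "braid_eq n `` {v}"])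
      (simp_all add: braid_mult_class braid_class_carrier equiv_class_eq[OF equiv_braid_eq])
qed (auto elim!: braid_carrierE simp: braid_mult_class braid_class_carrier)

section \<open>The Hurwitz action\<close>

text \<open>
  Tuples are lists, so the position \<open>i\<close> of a tuple, counted from 1, is the list index \<open>i - 1\<close>.
  The letter \<open>\<sigma>\<^sub>i\<inverse>\<close> replaces \<open>(g, h)\<close> in positions \<open>i, i + 1\<close> by \<open>(h, h\<inverse> g h)\<close>.
\<close>

fun hurwitz_letter :: "('a, 'b) monoid_scheme \<Rightarrow> nat \<times> bool \<Rightarrow> 'a list \<Rightarrow> 'a list"
  where
    "hurwitz_letter G (i, True) t =
      (let g = t ! (i - 1); h = t ! i in t[i - 1 := g \<otimes>\<^bsub>G\<^esub> h \<otimes>\<^bsub>G\<^esub> inv\<^bsub>G\<^esub> g, i := g])"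
  | "hurwitz_letter G (i, False) t =
      (let g = t ! (i - 1); h = t ! i in t[i - 1 := h, i := inv\<^bsub>G\<^esub> h \<otimes>\<^bsub>G\<^esub> g \<otimes>\<^bsub>G\<^esub> h])"

definition hurwitz_word :: "('a, 'b) monoid_scheme \<Rightarrow> braid_word \<Rightarrow> 'a list \<Rightarrow> 'a list"
  where "hurwitz_word G = foldr (hurwitz_letter G)"

definition tuples :: "('a, 'b) monoid_scheme \<Rightarrow> nat \<Rightarrow> 'a list set"
  where "tuples G n = {t. length t = n \<and> set t \<subseteq> carrier G}"

text \<open>The action of a braid is that of any word representing it.\<close>

definition hurwitz_action ::
    "('a, 'b) monoid_scheme \<Rightarrow> nat \<Rightarrow> braid_word set \<Rightarrow> 'a list \<Rightarrow> 'a list"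
  where "hurwitz_action G n x = (\<lambda>t\<in>tuples G n. THE u. \<forall>w\<in>x. u = hurwitz_word G w t)"

lemma hurwitz_letter_tuples:
  assumes "group G" "t \<in> tuples G n" "fst a \<in> {1..<n}"
  shows "hurwitz_letter G a t \<in> tuples G n"
proof -
  interpret group G by fact
  obtain i s where a: "a = (i, s)" by fastforce
  have "t ! (i - 1) \<in> carrier G" "t ! i \<in> carrier G"
    using assms(2,3) a by (auto simp: tuples_def subset_iff)
  then show ?thesis using assms(2,3) a
    by (cases s) (auto simp: tuples_def Let_def dest!: subsetD[OF set_update_subset_insert])
qed

lemma hurwitz_word_tuples:
  assumes "group G" "t \<in> tuples G n" "w \<in> braid_words n"
  shows "hurwitz_word G w t \<in> tuples G n"
  using assms(3) by (induction w) (auto simp: hurwitz_word_def assms intro!: hurwitz_letter_tuples)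

lemma hurwitz_word_append:
  "hurwitz_word G (v @ w) t = hurwitz_word G v (hurwitz_word G w t)"
  by (simp add: hurwitz_word_def)

lemma hurwitz_word_cong:
  assumes "group G" "(v, w) \<in> braid_eq n" "t \<in> tuples G n"
  shows "hurwitz_word G v t = hurwitz_word G w t"
  using assms(2,3)
proof (induction arbitrary: t rule: braid_eq.induct)
  case (congr v w a b)
  then show ?case
    by (simp add: hurwitz_word_append hurwitz_word_tuples[OF assms(1)])
next
  case (cancel i s)
  interpret group G by fact
  have conj: "x \<otimes>\<^bsub>G\<^esub> (inv\<^bsub>G\<^esub> x \<otimes>\<^bsub>G\<^esub> y \<otimes>\<^bsub>G\<^esub> x) \<otimes>\<^bsub>G\<^esub> inv\<^bsub>G\<^esub> x = y"
    "inv\<^bsub>G\<^esub> x \<otimes>\<^bsub>G\<^esub> (x \<otimes>\<^bsub>G\<^esub> y \<otimes>\<^bsub>G\<^esub> inv\<^bsub>G\<^esub> x) \<otimes>\<^bsub>G\<^esub> x = y"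
    if "x \<in> carrier G" "y \<in> carrier G" for x y
  proof -
    have "x \<otimes>\<^bsub>G\<^esub> (inv\<^bsub>G\<^esub> x \<otimes>\<^bsub>G\<^esub> y \<otimes>\<^bsub>G\<^esub> x) \<otimes>\<^bsub>G\<^esub> inv\<^bsub>G\<^esub> x = (x \<otimes>\<^bsub>G\<^esub> inv\<^bsub>G\<^esub> x) \<otimes>\<^bsub>G\<^esub> y \<otimes>\<^bsub>G\<^esub> (x \<otimes>\<^bsub>G\<^esub> inv\<^bsub>G\<^esub> x)"
      "inv\<^bsub>G\<^esub> x \<otimes>\<^bsub>G\<^esub> (x \<otimes>\<^bsub>G\<^esub> y \<otimes>\<^bsub>G\<^esub> inv\<^bsub>G\<^esub> x) \<otimes>\<^bsub>G\<^esub> x = (inv\<^bsub>G\<^esub> x \<otimes>\<^bsub>G\<^esub> x) \<otimes>\<^bsub>G\<^esub> y \<otimes>\<^bsub>G\<^esub> (inv\<^bsub>G\<^esub> x \<otimes>\<^bsub>G\<^esub> x)"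
      using that by (simp_all only: m_assoc m_closed inv_closed)
    then show "x \<otimes>\<^bsub>G\<^esub> (inv\<^bsub>G\<^esub> x \<otimes>\<^bsub>G\<^esub> y \<otimes>\<^bsub>G\<^esub> x) \<otimes>\<^bsub>G\<^esub> inv\<^bsub>G\<^esub> x = y"
      "inv\<^bsub>G\<^esub> x \<otimes>\<^bsub>G\<^esub> (x \<otimes>\<^bsub>G\<^esub> y \<otimes>\<^bsub>G\<^esub> inv\<^bsub>G\<^esub> x) \<otimes>\<^bsub>G\<^esub> x = y"
      using that by (simp_all only: r_inv l_inv l_one r_one)
  qed
  have c: "t ! (i - Suc 0) \<in> carrier G" "t ! i \<in> carrier G"
    using cancel by (auto simp: tuples_def subset_iff)
  have "length t = n" using cancel by (simp add: tuples_def)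
  then show ?case using cancel(1)
    by (cases s)
      (auto intro!: nth_equalityI simp: hurwitz_word_def Let_def nth_list_update
        conj[OF c(1,2)] conj[OF c(2,1)])
next
  case (far i j)
  interpret group G by fact
  have "length t = n" using far by (simp add: tuples_def)
  then show ?case using far(1-3)
    by (auto intro!: nth_equalityI simp: hurwitz_word_def Let_def nth_list_update)
next
  case (braid i)
  interpret group G by fact
  have conj: "g \<otimes>\<^bsub>G\<^esub> h \<otimes>\<^bsub>G\<^esub> inv\<^bsub>G\<^esub> g \<otimes>\<^bsub>G\<^esub> (g \<otimes>\<^bsub>G\<^esub> k \<otimes>\<^bsub>G\<^esub> inv\<^bsub>G\<^esub> g) \<otimes>\<^bsub>G\<^esub> inv\<^bsub>G\<^esub> (g \<otimes>\<^bsub>G\<^esub> h \<otimes>\<^bsub>G\<^esub> inv\<^bsub>G\<^esub> g)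
      = g \<otimes>\<^bsub>G\<^esub> (h \<otimes>\<^bsub>G\<^esub> k \<otimes>\<^bsub>G\<^esub> inv\<^bsub>G\<^esub> h) \<otimes>\<^bsub>G\<^esub> inv\<^bsub>G\<^esub> g"
    if "g \<in> carrier G" "h \<in> carrier G" "k \<in> carrier G" for g h k
  proof -
    have inv: "inv\<^bsub>G\<^esub> x \<otimes>\<^bsub>G\<^esub> (x \<otimes>\<^bsub>G\<^esub> y) = y"
      if "x \<in> carrier G" "y \<in> carrier G" for x y
      using that by (simp flip: m_assoc)
    show ?thesis using that by (simp add: m_assoc inv_mult_group inv)
  qed
  have c: "t ! (i - Suc 0) \<in> carrier G" "t ! i \<in> carrier G" "t ! Suc i \<in> carrier G"
    using braid by (auto simp: tuples_def subset_iff)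
  have "length t = n" using braid by (simp add: tuples_def)
  then show ?case using braid(1,2)
    by (auto intro!: nth_equalityI simp: hurwitz_word_def Let_def nth_list_update conj[OF c])
qed auto

lemma hurwitz_action_class:
  assumes "group G" "w \<in> braid_words n" "t \<in> tuples G n"
  shows "hurwitz_action G n (braid_eq n `` {w}) t = hurwitz_word G w t"
proof -
  let ?u = "hurwitz_word G w t"
  have w: "w \<in> braid_eq n `` {w}" using braid_eq.refl[OF assms(2)] by blast
  have eq: "?u = hurwitz_word G v t" if "v \<in> braid_eq n `` {w}" for v
    using hurwitz_word_cong[OF assms(1) _ assms(3)] that by blast
  have "(THE u. \<forall>v\<in>braid_eq n `` {w}. u = hurwitz_word G v t) = ?u"
  proof (rule the_equality)
    show "\<forall>v\<in>braid_eq n `` {w}. ?u = hurwitz_word G v t" using eq by (rule ballI)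
    show "u = ?u" if "\<forall>v\<in>braid_eq n `` {w}. u = hurwitz_word G v t" for u
      using bspec[OF that w] .
  qed
  then show ?thesis unfolding hurwitz_action_def restrict_apply'[OF assms(3)] .
qed

lemma group_action_hurwitz:
  assumes "group G"
  shows "group_action (braid_group n) (tuples G n) (hurwitz_action G n)"
proof -
  interpret B: group "braid_group n" by (rule group_braid_group)
  let ?T = "tuples G n"
  note act = hurwitz_action_class[OF assms]
  note tup = hurwitz_word_tuples[OF assms]
  have maps: "hurwitz_action G n x t \<in> ?T" if "x \<in> carrier (braid_group n)" "t \<in> ?T" for x t
    using that by (auto elim!: braid_carrierE simp: act tup)
  have mult: "hurwitz_action G n (x \<otimes>\<^bsub>braid_group n\<^esub> y) t
      = hurwitz_action G n x (hurwitz_action G n y t)"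
    if "x \<in> carrier (braid_group n)" "y \<in> carrier (braid_group n)" "t \<in> ?T" for x y t
    using that
    by (auto elim!: braid_carrierE simp: braid_mult_class act tup hurwitz_word_append)
  have one: "hurwitz_action G n \<one>\<^bsub>braid_group n\<^esub> t = t" if "t \<in> ?T" for t
    using act[of "[]" n t] that by (simp add: braid_group_def hurwitz_word_def)
  have bij: "hurwitz_action G n x \<in> Bij ?T" if x: "x \<in> carrier (braid_group n)" for x
  proof -
    have "bij_betw (hurwitz_action G n x) ?T ?T"
      using x by (intro bij_betw_byWitness[where f' = "hurwitz_action G n (inv\<^bsub>braid_group n\<^esub> x)"])
        (auto simp: mult[symmetric] one maps)
    then show ?thesis by (simp add: Bij_def hurwitz_action_def)
  qed
  show ?thesis
    unfolding group_action_def
  proof (rule group_hom.intro[OF group_braid_group group_BijGroup group_hom_axioms.intro], rule homI)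
    fix x y assume xy: "x \<in> carrier (braid_group n)" "y \<in> carrier (braid_group n)"
    show "hurwitz_action G n (x \<otimes>\<^bsub>braid_group n\<^esub> y)
        = hurwitz_action G n x \<otimes>\<^bsub>BijGroup ?T\<^esub> hurwitz_action G n y"
    proof
      fix t
      show "hurwitz_action G n (x \<otimes>\<^bsub>braid_group n\<^esub> y) t
          = (hurwitz_action G n x \<otimes>\<^bsub>BijGroup ?T\<^esub> hurwitz_action G n y) t"
      proof (cases "t \<in> ?T")
        case True
        then show ?thesis using xy bij by (simp add: BijGroup_def compose_def mult)
      next
        case False
        then show ?thesis using xy bij
          by (simp add: BijGroup_def compose_def) (simp add: hurwitz_action_def)
      qed
    qed
  qed (use bij in \<open>simp add: BijGroup_def\<close>)
qed

section \<open>The monoid of components\<close>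

definition braid_orbit :: "('a, 'b) monoid_scheme \<Rightarrow> 'a list \<Rightarrow> 'a list set"
  where "braid_orbit G t = orbit (braid_group (length t)) (hurwitz_action G (length t)) t"

definition tuple_prod :: "('a, 'b) monoid_scheme \<Rightarrow> 'a list \<Rightarrow> 'a"
  where "tuple_prod G t = foldr (\<otimes>\<^bsub>G\<^esub>) t \<one>\<^bsub>G\<^esub>"

text \<open>
  The components for a group \<open>G\<close>, a single conjugacy class \<open>c\<close> of \<open>G\<close> and multiplicity
  \<open>\<xi>(c) = 1\<close>. The product of two orbits is the orbit of the concatenation of representatives.
\<close>

definition Comp :: "('a, 'b) monoid_scheme \<Rightarrow> 'a set \<Rightarrow> 'a list set monoid"
  where "Comp G c =
    \<lparr> carrier = {braid_orbit G t | t. set t \<subseteq> c \<and> tuple_prod G t = \<one>\<^bsub>G\<^esub>},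
      monoid.mult = (\<lambda>x y. \<Union>s\<in>x. \<Union>t\<in>y. braid_orbit G (s @ t)),
      one = braid_orbit G [] \<rparr>"

definition transpositions :: "nat \<Rightarrow> (nat \<Rightarrow> nat) set"
  where "transpositions d = {transpose i j | i j. 1 \<le> i \<and> i < j \<and> j \<le> d}"

section \<open>Monoid algebras and their points\<close>

definition supp :: "('a \<Rightarrow> 'k::zero) \<Rightarrow> 'a set"
  where "supp f = {x. f x \<noteq> 0}"

definition monomial :: "'a \<Rightarrow> 'a \<Rightarrow> 'k::zero_neq_one"
  where "monomial x = (\<lambda>y. if y = x then 1 else 0)"

definition monoid_algebra :: "('a, 'b) monoid_scheme \<Rightarrow> ('k::field, 'a \<Rightarrow> 'k) module"
  where "monoid_algebra M =
    \<lparr> carrier = {f. finite (supp f) \<and> supp f \<subseteq> carrier M},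
      monoid.mult = (\<lambda>f g z. \<Sum>(x, y) \<in> {(x, y). x \<in> supp f \<and> y \<in> supp g \<and> x \<otimes>\<^bsub>M\<^esub> y = z}. f x * g y),
      one = monomial \<one>\<^bsub>M\<^esub>,
      ring.zero = (\<lambda>x. 0),
      ring.add = (\<lambda>f g x. f x + g x),
      Module.module.smult = (\<lambda>a f x. a * f x) \<rparr>"

definition k_points :: "('k::field, 'r) module \<Rightarrow> ('r \<Rightarrow> 'k) set"
  where "k_points R = {\<phi> \<in> ring_hom R ring_of_type_algebra \<inter> extensional (carrier R).
    \<forall>a. \<forall>f\<in>carrier R. \<phi> (a \<odot>\<^bsub>R\<^esub> f) = a * \<phi> f}"

definition ring_of_components :: "nat \<Rightarrow> ('k::field, (nat \<Rightarrow> nat) list set \<Rightarrow> 'k) module"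
  where "ring_of_components d = monoid_algebra (Comp (sym_group d) (transpositions d))"

section \<open>Coordinates\<close>

text \<open>
  The space \<open>k\<^bsup>d(d-1)/2\<^esup>\<close> consists of the functions on \<open>nat \<times> nat\<close> that vanish outside
  the set of index pairs, with pointwise operations.
\<close>

definition index_pairs :: "nat \<Rightarrow> (nat \<times> nat) set"
  where "index_pairs d = {(i, j). 1 \<le> i \<and> i < j \<and> j \<le> d}"

definition pair_component :: "nat \<Rightarrow> nat \<times> nat \<Rightarrow> (nat \<Rightarrow> nat) list set"
  where "pair_component d = (\<lambda>(i, j). braid_orbit (sym_group d) [transpose i j, transpose i j])"

definition coordinates ::
    "nat \<Rightarrow> (((nat \<Rightarrow> nat) list set \<Rightarrow> 'k::field) \<Rightarrow> 'k) \<Rightarrow> nat \<times> nat \<Rightarrow> 'k"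
  where "coordinates d \<phi> =
    (\<lambda>p. if p \<in> index_pairs d then \<phi> (monomial (pair_component d p)) else 0)"

definition e_set :: "nat \<Rightarrow> nat set \<Rightarrow> nat \<times> nat \<Rightarrow> 'k::field"
  where "e_set d A = (\<Sum>(i, j) \<in> {(i, j) \<in> index_pairs d. i \<in> A \<and> j \<in> A}. monomial (i, j))"

abbreviation span_k :: "('i \<Rightarrow> 'k::field) set \<Rightarrow> ('i \<Rightarrow> 'k) set"
  where "span_k \<equiv> Modules.module.span (\<lambda>a f x. a * f x)"

definition disjoint_families :: "nat \<Rightarrow> nat set set set"
  where "disjoint_families d = {F. F \<subseteq> Pow {1..d} \<and> disjoint F}"

definition maximal_disjoint_families :: "nat \<Rightarrow> nat set set set"
  where "maximal_disjoint_families d =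
    {F \<in> disjoint_families d. \<forall>F'\<in>disjoint_families d. F \<subseteq> F' \<longrightarrow> F' = F}"

end

theory Submission
  imports Defs
begin

text \<open>
  In the monoid of components, \<open>p\<^sub>i\<^sub>j p\<^sub>j\<^sub>k = p\<^sub>i\<^sub>k p\<^sub>j\<^sub>k\<close> for distinct \<open>i, j, k\<close>. Hence at a point \<open>x\<close>,
  if two of \<open>x\<^sub>i\<^sub>j, x\<^sub>j\<^sub>k, x\<^sub>i\<^sub>k\<close> are nonzero, then all three are equal, so that nonvanishing of \<open>x\<^sub>i\<^sub>j\<close>
  is an equivalence relation on \<open>{1..d}\<close> and \<open>x\<close> is constant on each class. Conversely, given
  disjoint blocks \<open>A\<close> with scalars \<open>\<lambda>\<^sub>A\<close>, choose square roots \<open>r\<^sub>A\<close> and give a transposition the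
  weight \<open>r\<^sub>A\<close> if it moves two points of \<open>A\<close> and \<open>0\<close> if it is contained in no block. The product
  of the weights over a tuple is invariant under braids and multiplicative under concatenation, and
  it takes the value \<open>\<lambda>\<^sub>A\<close> on \<open>p\<^sub>i\<^sub>j\<close> for \<open>i, j \<in> A\<close>.
\<close>

section \<open>Braid orbits\<close>

lemma tuplesI: "set t \<subseteq> carrier G \<Longrightarrow> t \<in> tuples G (length t)"
  by (simp add: tuples_def)

lemma braid_orbit_iff:
  assumes "group G" "set t \<subseteq> carrier G"
  shows "u \<in> braid_orbit G t \<longleftrightarrow> (\<exists>w\<in>braid_words (length t). u = hurwitz_word G w t)"
  using hurwitz_action_class[OF assms(1) _ tuplesI[OF assms(2)]]
  unfolding braid_orbit_def orbit_def
  by (auto elim!: braid_carrierE) (metis braid_class_carrier)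

lemma braid_orbit_refl:
  assumes "group G" "set t \<subseteq> carrier G"
  shows "t \<in> braid_orbit G t"
  using assms by (auto simp: braid_orbit_iff hurwitz_word_def intro!: bexI[of _ "[]"])

lemma braid_orbit_tuples:
  assumes "group G" "set t \<subseteq> carrier G" "u \<in> braid_orbit G t"
  shows "length u = length t" "set u \<subseteq> carrier G"
  using assms hurwitz_word_tuples[OF assms(1) tuplesI[OF assms(2)]]
  by (auto simp: braid_orbit_iff tuples_def)

lemma braid_orbit_eq:
  assumes "group G" "set t \<subseteq> carrier G" "u \<in> braid_orbit G t"
  shows "braid_orbit G u = braid_orbit G t"
proof -
  interpret A: group_action "braid_group (length t)" "tuples G (length t)"
      "hurwitz_action G (length t)"
    by (rule group_action_hurwitz[OF assms(1)])
  note len = braid_orbit_tuples[OF assms]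
  have t: "t \<in> tuples G (length t)" and u: "u \<in> tuples G (length t)"
    using assms(2) len by (auto simp: tuples_def)
  have ut: "u \<in> orbit (braid_group (length t)) (hurwitz_action G (length t)) t"
    using assms(3) by (simp add: braid_orbit_def)
  have tu: "t \<in> orbit (braid_group (length t)) (hurwitz_action G (length t)) u"
    by (rule A.orbit_sym[OF t u ut])
  have mem: "v \<in> tuples G (length t)"
    if "v \<in> orbit (braid_group (length t)) (hurwitz_action G (length t)) s"
      "s \<in> tuples G (length t)" for v s
    using that A.element_image by (auto simp: orbit_def)
  show ?thesis
    unfolding braid_orbit_def len(1)
    using A.orbit_trans[OF t u _ ut] A.orbit_trans[OF u t _ tu] mem t u by blast
qed

section \<open>Braids acting on concatenated tuples\<close>

lemma hurwitz_letter_append_left: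
  assumes "fst a \<in> {1..<length s}"
  shows "hurwitz_letter G a (s @ t) = hurwitz_letter G a s @ t"
proof (cases a)
  case (Pair i b)
  then show ?thesis using assms
    by (cases b) (auto simp: Let_def nth_append list_update_append)
qed

lemma hurwitz_letter_append_right:
  assumes "i \<in> {1..<length t}"
  shows "hurwitz_letter G (i + length s, b) (s @ t) = s @ hurwitz_letter G (i, b) t"
  using assms by (cases b) (auto simp: Let_def nth_append list_update_append)

lemma hurwitz_word_append_left:
  assumes "group G" "set s \<subseteq> carrier G" "w \<in> braid_words (length s)"
  shows "hurwitz_word G w (s @ t) = hurwitz_word G w s @ t"
  using assms(3)
proof (induction w)
  case (Cons a w)
  then have "length (hurwitz_word G w s) = length s"
    using hurwitz_word_tuples[OF assms(1) tuplesI[OF assms(2)]] by (simp add: tuples_def)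
  then show ?case
    using Cons by (simp add: hurwitz_word_def hurwitz_letter_append_left)
qed (simp add: hurwitz_word_def)

lemma hurwitz_word_append_right:
  assumes "group G" "set t \<subseteq> carrier G" "w \<in> braid_words (length t)"
  shows "hurwitz_word G (map (\<lambda>(i, b). (i + length s, b)) w) (s @ t) = s @ hurwitz_word G w t"
  using assms(3)
proof (induction w)
  case (Cons a w)
  then have "length (hurwitz_word G w t) = length t"
    using hurwitz_word_tuples[OF assms(1) tuplesI[OF assms(2)]] by (simp add: tuples_def)
  then show ?case
    using Cons by (cases a) (simp add: hurwitz_word_def hurwitz_letter_append_right)
qed (simp add: hurwitz_word_def)

text \<open>The word moving \<open>s\<close> is used unchanged on the first strands, and the word
  moving \<open>t\<close> is shifted by \<open>length s\<close> strands. This makes concatenation of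
  orbits independent of representatives.\<close>

lemma braid_orbit_append:
  assumes "group G" "set s \<subseteq> carrier G" "set t \<subseteq> carrier G"
    and "s' \<in> braid_orbit G s" "t' \<in> braid_orbit G t"
  shows "s' @ t' \<in> braid_orbit G (s @ t)"
proof -
  obtain v w where v: "v \<in> braid_words (length s)" "s' = hurwitz_word G v s"
    and w: "w \<in> braid_words (length t)" "t' = hurwitz_word G w t"
    using assms by (auto simp: braid_orbit_iff)
  let ?w = "map (\<lambda>(i, b). (i + length s, b)) w"
  have "v \<in> braid_words (length (s @ t))"
    using v(1) by (auto simp: braid_words_def in_lists_conv_set)
  moreover have "?w \<in> braid_words (length (s @ t))"
    using w(1) by (fastforce simp: braid_words_def in_lists_conv_set)
  moreover have "s' @ t' = hurwitz_word G (v @ ?w) (s @ t)"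
    using assms v w
    by (simp add: hurwitz_word_append hurwitz_word_append_right hurwitz_word_append_left)
  ultimately show ?thesis
    using assms(1-3) by (subst braid_orbit_iff) auto
qed

text \<open>The pair \<open>(g, g)\<close> has product 1, so \<open>h\<close> can be carried around it, conjugating it on the way.\<close>

lemma braid_orbit_conjugate_pair:
  assumes "group G" and carr: "g \<in> carrier G" "h \<in> carrier G" and g: "g \<otimes>\<^bsub>G\<^esub> g = \<one>\<^bsub>G\<^esub>"
  defines "k \<equiv> h \<otimes>\<^bsub>G\<^esub> g \<otimes>\<^bsub>G\<^esub> inv\<^bsub>G\<^esub> h"
  shows "braid_orbit G [k, k, h, h] = braid_orbit G [g, g, h, h]"
proof (rule braid_orbit_eq[OF assms(1)])
  interpret group G by fact
  have "inv\<^bsub>G\<^esub> g = g" using inv_equality[OF g] carr by simp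
  moreover have "g \<otimes>\<^bsub>G\<^esub> (g \<otimes>\<^bsub>G\<^esub> x) = x" if "x \<in> carrier G" for x
    using that carr g by (simp flip: m_assoc)
  ultimately have conj: "g \<otimes>\<^bsub>G\<^esub> (g \<otimes>\<^bsub>G\<^esub> h \<otimes>\<^bsub>G\<^esub> inv\<^bsub>G\<^esub> g) \<otimes>\<^bsub>G\<^esub> inv\<^bsub>G\<^esub> g = h"
    using carr g by (simp add: m_assoc)
  show "set [g, g, h, h] \<subseteq> carrier G" using carr by simp
  \<comment> \<open>The witness acts from its last letter to its first. With \<open>g\<close> of
    square 1, the tuple runs through \<open>[g, ghg^-1, g, h]\<close>, \<open>[h, g, g, h]\<close>,
    \<open>[k, h, g, h]\<close> and \<open>[k, k, h, h]\<close>: \<open>h\<close> passes the pair to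
    the left, coming out unchanged, and on the way back conjugates each \<open>g\<close>.\<close>
  show "[k, k, h, h] \<in> braid_orbit G [g, g, h, h]"
    using assms(1) carr conj
    by (subst braid_orbit_iff)
      (auto simp: hurwitz_word_def k_def numeral_2_eq_2
        intro!: bexI[of _ "[(2, True), (1, True), (1, True), (2, True)]"])
qed

lemma prod_list_hurwitz_letter:
  fixes \<mu> :: "'a \<Rightarrow> 'b::comm_monoid_mult"
  assumes "group G" "t \<in> tuples G n" "fst a \<in> {1..<n}"
    and conj: "\<And>g h. g \<in> carrier G \<Longrightarrow> h \<in> carrier G \<Longrightarrow> \<mu> (g \<otimes>\<^bsub>G\<^esub> h \<otimes>\<^bsub>G\<^esub> inv\<^bsub>G\<^esub> g) * \<mu> g = \<mu> h * \<mu> g"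
  shows "prod_list (map \<mu> (hurwitz_letter G a t)) = prod_list (map \<mu> t)"
proof -
  interpret group G by fact
  obtain i b where a: "a = (i, b)" by fastforce
  define xs where "xs = take (i - 1) t"
  define ys where "ys = drop (Suc i) t"
  define g where "g = t ! (i - 1)"
  define h where "h = t ! i"
  have i: "1 \<le> i" "i < length t" using assms(2,3) a by (auto simp: tuples_def)
  have "t = xs @ g # drop i t"
    using id_take_nth_drop[of "i - 1" t] i by (simp add: xs_def g_def)
  also have "drop i t = h # ys"
    using i by (simp add: h_def ys_def Cons_nth_drop_Suc)
  finally have t: "t = xs @ g # h # ys" .
  have i_xs: "i = Suc (length xs)" using i by (simp add: xs_def)
  have carr: "g \<in> carrier G" "h \<in> carrier G" using assms(2) t by (auto simp: tuples_def)
  show ?thesis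
  proof (cases b)
    case True
    have "hurwitz_letter G a t = xs @ (g \<otimes>\<^bsub>G\<^esub> h \<otimes>\<^bsub>G\<^esub> inv\<^bsub>G\<^esub> g) # g # ys"
      by (simp add: a True t i_xs Let_def nth_append list_update_append)
    then have "prod_list (map \<mu> (hurwitz_letter G a t)) = prod_list (map \<mu> xs) *
        (\<mu> (g \<otimes>\<^bsub>G\<^esub> h \<otimes>\<^bsub>G\<^esub> inv\<^bsub>G\<^esub> g) * \<mu> g) * prod_list (map \<mu> ys)"
      by (simp add: mult.assoc)
    then show ?thesis
      unfolding conj[OF carr] by (simp add: t mult_ac)
  next
    case False
    \<comment> \<open>The inverse letter turns \<open>(g, h)\<close> into \<open>(h, ?k)\<close>.
      Since \<open>g\<close> is the conjugate of \<open>?k\<close> by \<open>h\<close>, the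
      hypothesis on \<mu> applies to \<open>h\<close> and \<open>?k\<close>.\<close>
    let ?k = "inv\<^bsub>G\<^esub> h \<otimes>\<^bsub>G\<^esub> g \<otimes>\<^bsub>G\<^esub> h"
    have "h \<otimes>\<^bsub>G\<^esub> ?k \<otimes>\<^bsub>G\<^esub> inv\<^bsub>G\<^esub> h = (h \<otimes>\<^bsub>G\<^esub> inv\<^bsub>G\<^esub> h) \<otimes>\<^bsub>G\<^esub> g \<otimes>\<^bsub>G\<^esub> (h \<otimes>\<^bsub>G\<^esub> inv\<^bsub>G\<^esub> h)"
      using carr by (simp only: m_assoc m_closed inv_closed)
    then have "h \<otimes>\<^bsub>G\<^esub> ?k \<otimes>\<^bsub>G\<^esub> inv\<^bsub>G\<^esub> h = g" using carr by simp
    then have k: "\<mu> ?k * \<mu> h = \<mu> g * \<mu> h" using conj[of h ?k] carr by simp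
    have "hurwitz_letter G a t = xs @ h # ?k # ys"
      by (simp add: a False t i_xs Let_def nth_append list_update_append)
    then have "prod_list (map \<mu> (hurwitz_letter G a t)) = prod_list (map \<mu> xs) *
        (\<mu> ?k * \<mu> h) * prod_list (map \<mu> ys)"
      by (simp add: mult_ac)
    then show ?thesis
      unfolding k by (simp add: t mult_ac)
  qed
qed

lemma prod_list_braid_orbit:
  fixes \<mu> :: "'a \<Rightarrow> 'b::comm_monoid_mult"
  assumes "group G" "set t \<subseteq> carrier G" "u \<in> braid_orbit G t"
    and conj: "\<And>g h. g \<in> carrier G \<Longrightarrow> h \<in> carrier G \<Longrightarrow> \<mu> (g \<otimes>\<^bsub>G\<^esub> h \<otimes>\<^bsub>G\<^esub> inv\<^bsub>G\<^esub> g) * \<mu> g = \<mu> h * \<mu> g"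
  shows "prod_list (map \<mu> u) = prod_list (map \<mu> t)"
proof -
  obtain w where w: "w \<in> braid_words (length t)" "u = hurwitz_word G w t"
    using assms by (auto simp: braid_orbit_iff)
  have "prod_list (map \<mu> (hurwitz_word G w t)) = prod_list (map \<mu> t)"
    using w(1)
  proof (induction w)
    case (Cons a w)
    then have "hurwitz_word G w t \<in> tuples G (length t)"
      using hurwitz_word_tuples[OF assms(1) tuplesI[OF assms(2)]] by simp
    then have "prod_list (map \<mu> (hurwitz_letter G a (hurwitz_word G w t)))
        = prod_list (map \<mu> (hurwitz_word G w t))"
      using Cons.prems by (intro prod_list_hurwitz_letter[where \<mu> = \<mu>, OF assms(1) _ _ conj]) auto
    then show ?case using Cons by (simp add: hurwitz_word_def)
  qed (simp add: hurwitz_word_def)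
  then show ?thesis using w(2) by simp
qed

section \<open>The monoid of components\<close>

lemma Comp_mult:
  assumes "group G" "set s \<subseteq> carrier G" "set t \<subseteq> carrier G"
  shows "braid_orbit G s \<otimes>\<^bsub>Comp G c\<^esub> braid_orbit G t = braid_orbit G (s @ t)"
proof -
  have st: "set (s @ t) \<subseteq> carrier G" using assms by simp
  have eq: "braid_orbit G (s' @ t') = braid_orbit G (s @ t)"
    if "s' \<in> braid_orbit G s" "t' \<in> braid_orbit G t" for s' t'
    using braid_orbit_eq[OF assms(1) st braid_orbit_append[OF assms that]] .
  have "braid_orbit G s \<otimes>\<^bsub>Comp G c\<^esub> braid_orbit G t
      = (\<Union>s'\<in>braid_orbit G s. \<Union>t'\<in>braid_orbit G t. braid_orbit G (s @ t))"
    by (simp add: Comp_def eq cong: SUP_cong)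
  \<comment> \<open>The union of a constant family equals that constant only over nonempty index
    sets; each orbit contains its own representative.\<close>
  also have "\<dots> = braid_orbit G (s @ t)"
    using braid_orbit_refl[OF assms(1,2)] braid_orbit_refl[OF assms(1,3)] by blast
  finally show ?thesis .
qed

lemma tuple_prod_append:
  assumes "group G" "set s \<subseteq> carrier G" "set t \<subseteq> carrier G"
  shows "tuple_prod G (s @ t) = tuple_prod G s \<otimes>\<^bsub>G\<^esub> tuple_prod G t"
proof -
  interpret group G by fact
  have closed: "tuple_prod G u \<in> carrier G" if "set u \<subseteq> carrier G" for u
    using that by (induction u) (auto simp: tuple_prod_def)
  show ?thesis
    using assms(2)
  proof (induction s)
    case Nil
    then show ?case using closed[OF assms(3)] by (simp add: tuple_prod_def)
  next
    case (Cons g s)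
    then show ?case
      using closed[OF assms(3)] closed[of s] by (simp add: tuple_prod_def m_assoc)
  qed
qed

lemma CompE:
  assumes "x \<in> carrier (Comp G c)"
  obtains t where "x = braid_orbit G t" "set t \<subseteq> c" "tuple_prod G t = \<one>\<^bsub>G\<^esub>"
  using assms by (auto simp: Comp_def)

lemma Comp_mult_closed:
  assumes "group G" "c \<subseteq> carrier G" "x \<in> carrier (Comp G c)" "y \<in> carrier (Comp G c)"
  shows "x \<otimes>\<^bsub>Comp G c\<^esub> y \<in> carrier (Comp G c)"
proof -
  interpret group G by fact
  obtain s t where s: "x = braid_orbit G s" "set s \<subseteq> c" "tuple_prod G s = \<one>\<^bsub>G\<^esub>"
    and t: "y = braid_orbit G t" "set t \<subseteq> c" "tuple_prod G t = \<one>\<^bsub>G\<^esub>"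
    using assms(3,4) by (elim CompE)
  have st: "set s \<subseteq> carrier G" "set t \<subseteq> carrier G" using s(2) t(2) assms(2) by auto
  have "x \<otimes>\<^bsub>Comp G c\<^esub> y = braid_orbit G (s @ t)"
    using Comp_mult[OF assms(1) st] s(1) t(1) by simp
  moreover have "set (s @ t) \<subseteq> c" "tuple_prod G (s @ t) = \<one>\<^bsub>G\<^esub>"
    using s t tuple_prod_append[OF assms(1) st] by auto
  ultimately show ?thesis unfolding Comp_def by (auto intro!: exI[of _ "s @ t"])
qed

lemma Comp_one_closed: "\<one>\<^bsub>Comp G c\<^esub> \<in> carrier (Comp G c)"
  by (auto simp: Comp_def tuple_prod_def intro!: exI[of _ "[]"])

section \<open>Points of monoid algebras\<close>

lemma supp_monomial [simp]: "supp (monomial x :: 'a \<Rightarrow> 'k::zero_neq_one) = {x}"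
  by (auto simp: supp_def monomial_def)

lemma monomial_carrier:
  "x \<in> carrier M \<Longrightarrow> monomial x \<in> carrier (monoid_algebra M)"
  by (simp add: monoid_algebra_def)

lemma monomial_mult:
  "monomial x \<otimes>\<^bsub>monoid_algebra M\<^esub> monomial y = monomial (x \<otimes>\<^bsub>M\<^esub> y)"
proof
  fix z
  have "{(a, b). a \<in> {x} \<and> b \<in> {y} \<and> a \<otimes>\<^bsub>M\<^esub> b = z} = (if z = x \<otimes>\<^bsub>M\<^esub> y then {(x, y)} else {})"
    by auto
  then show "(monomial x \<otimes>\<^bsub>monoid_algebra M\<^esub> monomial y) z = monomial (x \<otimes>\<^bsub>M\<^esub> y) z"
    by (simp add: monoid_algebra_def) (simp add: monomial_def)
qed

lemma k_points_mult:
  assumes "\<phi> \<in> k_points (monoid_algebra M)" "x \<in> carrier M" "y \<in> carrier M"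
  shows "\<phi> (monomial (x \<otimes>\<^bsub>M\<^esub> y)) = \<phi> (monomial x) * \<phi> (monomial y)"
  using ring_hom_mult[of \<phi> "monoid_algebra M" ring_of_type_algebra "monomial x" "monomial y"] assms
  by (simp add: k_points_def monomial_carrier monomial_mult ring_of_type_algebra_def)

text \<open>Universal property of the monoid algebra: the point is the linear extension of
  \<chi>.\<close>

lemma k_point_of_character:
  fixes \<chi> :: "'a \<Rightarrow> 'k::field" and M :: "('a, 'b) monoid_scheme"
  assumes closed: "\<And>x y. x \<in> carrier M \<Longrightarrow> y \<in> carrier M \<Longrightarrow> x \<otimes>\<^bsub>M\<^esub> y \<in> carrier M"
    and one: "\<one>\<^bsub>M\<^esub> \<in> carrier M" "\<chi> \<one>\<^bsub>M\<^esub> = 1"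
    and mult: "\<And>x y. x \<in> carrier M \<Longrightarrow> y \<in> carrier M \<Longrightarrow> \<chi> (x \<otimes>\<^bsub>M\<^esub> y) = \<chi> x * \<chi> y"
  obtains \<phi> where "\<phi> \<in> k_points (monoid_algebra M)"
    "\<And>x. x \<in> carrier M \<Longrightarrow> \<phi> (monomial x) = \<chi> x"
proof
  let ?R = "monoid_algebra M :: ('k, 'a \<Rightarrow> 'k) module"
  define \<psi> where "\<psi> f = (\<Sum>x\<in>supp f. f x * \<chi> x)" for f
  have carr: "f \<in> carrier ?R \<longleftrightarrow> finite (supp f) \<and> supp f \<subseteq> carrier M" for f
    by (simp add: monoid_algebra_def)
  \<comment> \<open>The sum may run over any finite set containing the support. This provides common
    index sets for sums and products, where cancellation can shrink the support.\<close>
  have \<psi>: "\<psi> f = (\<Sum>x\<in>S. f x * \<chi> x)" if "finite S" "supp f \<subseteq> S" for f S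
    unfolding \<psi>_def using that by (intro sum.mono_neutral_left) (auto simp: supp_def)
  have add_closed: "f \<oplus>\<^bsub>?R\<^esub> g \<in> carrier ?R" and add: "\<psi> (f \<oplus>\<^bsub>?R\<^esub> g) = \<psi> f + \<psi> g"
    if "f \<in> carrier ?R" "g \<in> carrier ?R" for f g
  proof -
    let ?S = "supp f \<union> supp g"
    have sub: "supp (f \<oplus>\<^bsub>?R\<^esub> g) \<subseteq> ?S" by (auto simp: supp_def monoid_algebra_def)
    have fin: "finite ?S" using that by (simp add: carr)
    show "f \<oplus>\<^bsub>?R\<^esub> g \<in> carrier ?R"
      using that sub finite_subset[OF sub fin] by (auto simp: carr)
    have "\<psi> (f \<oplus>\<^bsub>?R\<^esub> g) = (\<Sum>x\<in>?S. f x * \<chi> x) + (\<Sum>x\<in>?S. g x * \<chi> x)"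
      unfolding \<psi>[OF fin sub] by (simp add: monoid_algebra_def distrib_right sum.distrib)
    also have "\<dots> = \<psi> f + \<psi> g" using \<psi>[OF fin] by simp
    finally show "\<psi> (f \<oplus>\<^bsub>?R\<^esub> g) = \<psi> f + \<psi> g" .
  qed
  have mult_closed: "f \<otimes>\<^bsub>?R\<^esub> g \<in> carrier ?R" and mult': "\<psi> (f \<otimes>\<^bsub>?R\<^esub> g) = \<psi> f * \<psi> g"
    if f: "f \<in> carrier ?R" and g: "g \<in> carrier ?R" for f g
  proof -
    let ?P = "supp f \<times> supp g"
    let ?m = "\<lambda>(x, y). x \<otimes>\<^bsub>M\<^esub> y"
    have fin: "finite ?P" using f g by (simp add: carr)
    have eq: "(f \<otimes>\<^bsub>?R\<^esub> g) z = (\<Sum>p\<in>{p \<in> ?P. ?m p = z}. f (fst p) * g (snd p))" for z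
      unfolding monoid_algebra_def by (auto intro!: sum.cong)
    have sub: "supp (f \<otimes>\<^bsub>?R\<^esub> g) \<subseteq> ?m ` ?P"
    proof
      fix z assume "z \<in> supp (f \<otimes>\<^bsub>?R\<^esub> g)"
      then have "(\<Sum>p\<in>{p \<in> ?P. ?m p = z}. f (fst p) * g (snd p)) \<noteq> 0"
        unfolding supp_def eq by simp
      then have "{p \<in> ?P. ?m p = z} \<noteq> {}" by (metis sum.empty)
      then show "z \<in> ?m ` ?P" by blast
    qed
    have "?m ` ?P \<subseteq> carrier M" using f g closed by (auto simp: carr)
    then show "f \<otimes>\<^bsub>?R\<^esub> g \<in> carrier ?R"
      using sub finite_subset[OF sub] fin by (auto simp: carr)
    \<comment> \<open>The pairs of support elements are grouped by their product in
      \<open>M\<close>; undoing this grouping leaves a double sum that factors because \<chi> is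
      multiplicative.\<close>
    have "\<psi> (f \<otimes>\<^bsub>?R\<^esub> g)
        = (\<Sum>z\<in>?m ` ?P. \<Sum>p\<in>{p \<in> ?P. ?m p = z}. f (fst p) * g (snd p) * \<chi> (?m p))"
      using fin unfolding \<psi>[OF finite_imageI[OF fin] sub] eq
      by (auto simp: sum_distrib_right intro!: sum.cong)
    also have "\<dots> = (\<Sum>p\<in>?P. f (fst p) * g (snd p) * \<chi> (?m p))"
      by (rule sum.group) (use fin in auto)
    also have "\<dots> = (\<Sum>p\<in>?P. (f (fst p) * \<chi> (fst p)) * (g (snd p) * \<chi> (snd p)))"
      using f g by (intro sum.cong refl) (auto simp: carr mult subset_iff)
    also have "\<dots> = \<psi> f * \<psi> g"
      by (simp add: \<psi>_def sum_product sum.cartesian_product case_prod_beta)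
    finally show "\<psi> (f \<otimes>\<^bsub>?R\<^esub> g) = \<psi> f * \<psi> g" .
  qed
  have smult_closed: "a \<odot>\<^bsub>?R\<^esub> f \<in> carrier ?R" and smult: "\<psi> (a \<odot>\<^bsub>?R\<^esub> f) = a * \<psi> f"
    if f: "f \<in> carrier ?R" for a f
  proof -
    have sub: "supp (a \<odot>\<^bsub>?R\<^esub> f) \<subseteq> supp f" by (auto simp: supp_def monoid_algebra_def)
    have fin: "finite (supp f)" using f by (simp add: carr)
    show "a \<odot>\<^bsub>?R\<^esub> f \<in> carrier ?R" using f sub finite_subset[OF sub fin] by (auto simp: carr)
    show "\<psi> (a \<odot>\<^bsub>?R\<^esub> f) = a * \<psi> f"
      by (subst \<psi>[OF fin sub]) (simp add: \<psi>_def monoid_algebra_def sum_distrib_left mult.assoc)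
  qed
  have monomial: "\<psi> (monomial x) = \<chi> x" for x
    by (simp add: \<psi>_def) (simp add: monomial_def)
  have one': "\<one>\<^bsub>?R\<^esub> = monomial \<one>\<^bsub>M\<^esub>" by (simp add: monoid_algebra_def)
  \<comment> \<open>Members of \<open>k_points\<close> are extensional, hence the restriction to the
    carrier.\<close>
  have "restrict \<psi> (carrier ?R) \<in> ring_hom ?R ring_of_type_algebra"
    by (rule ring_hom_memI)
      (auto simp: ring_of_type_algebra_def add_closed add mult_closed mult' one' monomial
        monomial_carrier one)
  then show "restrict \<psi> (carrier ?R) \<in> k_points ?R"
    by (auto simp: k_points_def smult_closed smult)
  show "restrict \<psi> (carrier ?R) (monomial x) = \<chi> x" if "x \<in> carrier M" for x
    using that by (simp add: monomial_carrier monomial)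
qed

text \<open>The product of the weights along a tuple is constant on braid orbits and multiplicative
  under concatenation, so it descends to a character of \<open>Comp G c\<close>, evaluated below at
  an arbitrarily chosen representative.\<close>

lemma k_point_of_weight:
  fixes \<mu> :: "'a \<Rightarrow> 'k::field"
  assumes "group G" "c \<subseteq> carrier G"
    and conj: "\<And>g h. g \<in> carrier G \<Longrightarrow> h \<in> carrier G \<Longrightarrow> \<mu> (g \<otimes>\<^bsub>G\<^esub> h \<otimes>\<^bsub>G\<^esub> inv\<^bsub>G\<^esub> g) * \<mu> g = \<mu> h * \<mu> g"
  obtains \<phi> where "\<phi> \<in> k_points (monoid_algebra (Comp G c))"
    "\<And>t. set t \<subseteq> c \<Longrightarrow> tuple_prod G t = \<one>\<^bsub>G\<^esub>
      \<Longrightarrow> \<phi> (monomial (braid_orbit G t)) = prod_list (map \<mu> t)"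
proof -
  define \<chi> where "\<chi> x = prod_list (map \<mu> (SOME t. t \<in> x))" for x
  have \<chi>: "\<chi> (braid_orbit G t) = prod_list (map \<mu> t)" if "set t \<subseteq> carrier G" for t
  proof -
    have "(SOME u. u \<in> braid_orbit G t) \<in> braid_orbit G t"
      using braid_orbit_refl[OF assms(1) that] by (rule someI)
    then show ?thesis
      unfolding \<chi>_def by (rule prod_list_braid_orbit[where \<mu> = \<mu>, OF assms(1) that _ conj])
  qed
  have "\<chi> (x \<otimes>\<^bsub>Comp G c\<^esub> y) = \<chi> x * \<chi> y"
    if xy: "x \<in> carrier (Comp G c)" "y \<in> carrier (Comp G c)" for x y
  proof -
    obtain s t where s: "x = braid_orbit G s" "set s \<subseteq> c" and t: "y = braid_orbit G t" "set t \<subseteq> c"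
      using xy by (elim CompE)
    have "set s \<subseteq> carrier G" "set t \<subseteq> carrier G" using s(2) t(2) assms(2) by auto
    then show ?thesis using \<chi> by (simp add: s(1) t(1) Comp_mult[OF assms(1)])
  qed
  moreover have "\<chi> \<one>\<^bsub>Comp G c\<^esub> = 1" using \<chi>[of "[]"] by (simp add: Comp_def)
  ultimately obtain \<phi> where \<phi>: "\<phi> \<in> k_points (monoid_algebra (Comp G c))"
    "\<And>x. x \<in> carrier (Comp G c) \<Longrightarrow> \<phi> (monomial x) = \<chi> x"
    using k_point_of_character[of "Comp G c" \<chi>] Comp_mult_closed[OF assms(1,2)] Comp_one_closed
    by blast
  show ?thesis
  proof (rule that[OF \<phi>(1)])
    fix t assume t: "set t \<subseteq> c" "tuple_prod G t = \<one>\<^bsub>G\<^esub>"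
    then have "braid_orbit G t \<in> carrier (Comp G c)" unfolding Comp_def by auto
    then show "\<phi> (monomial (braid_orbit G t)) = prod_list (map \<mu> t)"
      using \<phi>(2) \<chi>[of t] t(1) assms(2) by auto
  qed
qed

section \<open>Spans\<close>

lemma module_fun: "Modules.module (\<lambda>(a::'k::field) f (x::'i). a * f x)"
  by unfold_locales (auto simp: fun_eq_iff algebra_simps)

lemma span_k_image:
  fixes e :: "'a \<Rightarrow> 'i \<Rightarrow> 'k::field"
  assumes "finite F"
  shows "x \<in> span_k (e ` F) \<longleftrightarrow> (\<exists>c. \<forall>p. x p = (\<Sum>A\<in>F. c A * e A p))"
proof
  interpret V: Modules.module "\<lambda>(a::'k) f (x::'i). a * f x" by (rule module_fun)
  show "\<exists>c. \<forall>p. x p = (\<Sum>A\<in>F. c A * e A p)" if "x \<in> span_k (e ` F)"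
    using that
  proof (induction rule: V.span_induct_alt)
    case base
    then show ?case by (auto intro!: exI[of _ "\<lambda>_. 0"])
  next
    case (step a v y)
    then obtain B c where B: "B \<in> F" "v = e B" "\<forall>p. y p = (\<Sum>A\<in>F. c A * e A p)" by auto
    have "(\<Sum>A\<in>F. (c(B := c B + a)) A * e A p) = a * v p + y p" for p
      using assms B by (simp add: sum.remove[OF assms B(1)] algebra_simps)
    then show ?case by (intro exI[of _ "c(B := c B + a)"]) auto
  qed
  show "x \<in> span_k (e ` F)" if ex: "\<exists>c. \<forall>p. x p = (\<Sum>A\<in>F. c A * e A p)"
  proof -
    obtain c where c: "\<forall>p. x p = (\<Sum>A\<in>F. c A * e A p)" using ex by blast
    have sum_app: "(\<Sum>A\<in>S. g A) p = (\<Sum>A\<in>S. g A p)" for g :: "'a \<Rightarrow> 'i \<Rightarrow> 'k" and S p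
      by (induction S rule: infinite_finite_induct) auto
    have "x = (\<Sum>A\<in>F. (\<lambda>p. c A * e A p))" using c by (auto simp: fun_eq_iff sum_app)
    then show ?thesis by (auto intro: V.span_sum V.span_scale V.span_base)
  qed
qed

lemma e_set_apply:
  "e_set d A p = (if p \<in> index_pairs d \<and> fst p \<in> A \<and> snd p \<in> A then 1 else 0 :: 'k::field)"
proof -
  let ?S = "{(i, j) \<in> index_pairs d. i \<in> A \<and> j \<in> A}"
  have "finite (index_pairs d)"
    by (rule finite_subset[of _ "{1..d} \<times> {1..d}"]) (auto simp: index_pairs_def)
  then have fin: "finite ?S" by (rule rev_finite_subset) auto
  have sum_app: "(\<Sum>q\<in>S. g q) p = (\<Sum>q\<in>S. g q p)"
    for g :: "nat \<times> nat \<Rightarrow> nat \<times> nat \<Rightarrow> 'k" and S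
    by (induction S rule: infinite_finite_induct) auto
  have "e_set d A p = (\<Sum>q\<in>?S. monomial q p :: 'k)"
    unfolding e_set_def sum_app by (intro sum.cong) auto
  also have "\<dots> = (if p \<in> ?S then 1 else 0)"
    unfolding monomial_def using fin by simp
  finally show ?thesis by (auto simp: case_prod_beta)
qed

lemma finite_disjoint_families: "finite (disjoint_families d)"
  by (rule finite_subset[of _ "Pow (Pow {1..d})"]) (auto simp: disjoint_families_def)

lemma mem_span_disjoint_family:
  assumes F: "F \<in> disjoint_families d"
  shows "x \<in> span_k (e_set d ` F) \<longleftrightarrow>
    (\<exists>c. \<forall>p. x p = (\<Sum>A\<in>F. if p \<in> index_pairs d \<and> fst p \<in> A \<and> snd p \<in> A then c A else 0 :: 'k::field))"
proof -
  have "finite F"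
    using F finite_subset[of F "Pow {1..d}"] by (simp add: disjoint_families_def)
  then show ?thesis
    by (simp add: span_k_image e_set_apply if_distrib cong: if_cong)
qed

section \<open>Points of the ring of components\<close>

lemma transposition_carrier:
  assumes "i \<in> {1..d}" "j \<in> {1..d}"
  shows "transpose i j \<in> carrier (sym_group d)"
  using assms by (simp add: sym_group_carrier permutes_swap_id)

lemma transposition_in_transpositions:
  assumes "i \<in> {1..d}" "j \<in> {1..d}" "i \<noteq> j"
  shows "transpose i j \<in> transpositions d"
proof (cases "i < j")
  case True
  then show ?thesis using assms unfolding transpositions_def by auto
next
  case False
  then have "transpose j i \<in> transpositions d"
    using assms unfolding transpositions_def by (intro CollectI exI[of _ j] exI[of _ i]) auto
  then show ?thesis by (simp add: transpose_commute)
qed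

lemma transpositions_subset: "transpositions d \<subseteq> carrier (sym_group d)"
  by (auto simp: transpositions_def intro!: transposition_carrier)

lemma tuple_prod_transposition_pair:
  "tuple_prod (sym_group d) [transpose i j, transpose i j] = \<one>\<^bsub>sym_group d\<^esub>"
  by (simp add: tuple_prod_def sym_group_mult sym_group_one)

lemma pair_component_carrier:
  assumes "i \<in> {1..d}" "j \<in> {1..d}" "i \<noteq> j"
  shows "pair_component d (i, j) \<in> carrier (Comp (sym_group d) (transpositions d))"
  unfolding pair_component_def Comp_def
  using transposition_in_transpositions[OF assms] tuple_prod_transposition_pair[of d i j]
  by (auto intro!: exI[of _ "[transpose i j, transpose i j]"])

lemma pair_component_commute: "pair_component d (i, j) = pair_component d (j, i)"
  by (simp add: pair_component_def transpose_commute)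

text \<open>Conjugating \<open>(i j)\<close> by \<open>(j k)\<close> gives \<open>(i k)\<close>, so
  this is \<open>braid_orbit_conjugate_pair\<close> with \<open>g = (i j)\<close> and
  \<open>h = (j k)\<close>.\<close>

lemma pair_component_relation:
  assumes ijk: "i \<in> {1..d}" "j \<in> {1..d}" "k \<in> {1..d}" "i \<noteq> j" "j \<noteq> k" "i \<noteq> k"
  shows "pair_component d (i, j) \<otimes>\<^bsub>Comp (sym_group d) c\<^esub> pair_component d (j, k)
    = pair_component d (i, k) \<otimes>\<^bsub>Comp (sym_group d) c\<^esub> pair_component d (j, k)"
proof -
  let ?g = "transpose i j" and ?h = "transpose j k"
  note carr = transposition_carrier[OF ijk(1,2)] transposition_carrier[OF ijk(2,3)]
    transposition_carrier[OF ijk(1,3)]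
  have conj: "?h \<circ> ?g \<circ> ?h = transpose i k"
    using ijk by (auto simp: fun_eq_iff transpose_def)
  show ?thesis
    using braid_orbit_conjugate_pair[OF sym_group_is_group carr(1,2)] carr
    by (simp add: pair_component_def Comp_mult[OF sym_group_is_group] sym_group_mult sym_group_one
        inv_transpose_eq conj)
qed

section \<open>Every point lies in the span of a disjoint family\<close>

lemma coordinates_in_span:
  fixes \<phi> :: "((nat \<Rightarrow> nat) list set \<Rightarrow> 'k::field) \<Rightarrow> 'k"
  assumes "\<phi> \<in> k_points (ring_of_components d)"
  obtains F where "F \<in> disjoint_families d" "coordinates d \<phi> \<in> span_k (e_set d ` F)"
proof -
  define y where "y i j = \<phi> (monomial (pair_component d (i, j)))" for i j
  have sym: "y i j = y j i" for i j
    using pair_component_commute[of d i j] by (simp add: y_def)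
  have rel: "y i j * y j k = y i k * y j k"
    if "i \<in> {1..d}" "j \<in> {1..d}" "k \<in> {1..d}" "i \<noteq> j" "j \<noteq> k" "i \<noteq> k" for i j k
    using assms that pair_component_relation[of i d j k "transpositions d"] unfolding y_def ring_of_components_def
    by (metis k_points_mult pair_component_carrier)
  \<comment> \<open>Cancelling \<open>y j i\<close> in the relation for \<open>k, j, i\<close>. This
    gives transitivity of nonvanishing.\<close>
  have propagate: "y i k = y j k"
    if "i \<in> {1..d}" "j \<in> {1..d}" "k \<in> {1..d}" "i \<noteq> j" "j \<noteq> k" "i \<noteq> k" "y i j \<noteq> 0" for i j k
    using rel[of k j i] rel[of k i j] sym[of i j] sym[of k i] sym[of k j] that by auto
  \<comment> \<open>Cancelling \<open>y j k\<close> in the relation for \<open>i, j, k\<close>. This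
    gives constancy on the classes.\<close>
  have propagate': "y i k = y i j"
    if "i \<in> {1..d}" "j \<in> {1..d}" "k \<in> {1..d}" "i \<noteq> j" "j \<noteq> k" "i \<noteq> k" "y i j \<noteq> 0" "y j k \<noteq> 0"
    for i j k
    using rel[of i j k] that by auto
  \<comment> \<open>\<open>C i\<close> is the class of \<open>i\<close>. The diagonal is put in by
    hand: \<open>transpose i i\<close> is the identity and not a transposition, so
    \<open>y i i\<close> carries no information.\<close>
  define C where "C i = {j \<in> {1..d}. i = j \<or> y i j \<noteq> 0}" for i
  have C_eq: "C i = C j" if "i \<in> {1..d}" "j \<in> {1..d}" "i = j \<or> y i j \<noteq> 0" for i j
    using that propagate[of i j] sym unfolding C_def by (auto; metis)
  let ?F = "C ` {1..d}"
  have F: "?F \<in> disjoint_families d"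
  proof -
    have "C i = C j" if "i \<in> {1..d}" "j \<in> {1..d}" "l \<in> C i" "l \<in> C j" for i j l
      using that C_eq[of i l] C_eq[of j l] by (auto simp: C_def)
    then have "disjoint ?F" unfolding pairwise_def disjnt_def by blast
    then show ?thesis by (auto simp: disjoint_families_def C_def)
  qed
  have const: "y i j = y a b" if "i \<in> C l" "j \<in> C l" "a \<in> C l" "b \<in> C l" "i \<noteq> j" "a \<noteq> b"
      "l \<in> {1..d}" for i j a b l
  proof -
    have in_d: "m \<in> {1..d}" if "m \<in> C l" for m using that by (simp add: C_def)
    have nz: "y m n \<noteq> 0" if "m \<in> C l" "n \<in> C l" "m \<noteq> n" for m n
    proof -
      have "C m = C l" using that(1) C_eq[of l m] \<open>l \<in> {1..d}\<close> by (auto simp: C_def)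
      then have "n \<in> C m" using that by simp
      then show ?thesis using that(3) by (simp add: C_def)
    qed
    have step: "y m n = y m n'" if "m \<in> C l" "n \<in> C l" "n' \<in> C l" "m \<noteq> n" "m \<noteq> n'" for m n n'
      using propagate'[of m n n'] in_d nz that by (cases "n = n'") auto
    \<comment> \<open>The index pair is changed one entry at a time, from \<open>i, j\<close> to
      \<open>i, b\<close> and, after swapping, from \<open>b, i\<close> to \<open>b, a\<close>. The
      intermediate pair \<open>i, b\<close> must be off the diagonal, so \<open>i = b\<close> is
      treated apart.\<close>
    show ?thesis
    proof (cases "i = b")
      case True
      then show ?thesis using step[of i j a] sym[of a b] that by auto
    next
      case False
      then have "y i j = y i b" using step[of i j b] that by auto
      also have "\<dots> = y b a" using step[of b i a] sym[of i b] that False by auto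
      finally show ?thesis using sym by simp
    qed
  qed
  \<comment> \<open>The common off-diagonal value of \<open>y\<close> on a block. On a one-element
    block the choice is arbitrary and harmless, as no index pair lies inside it.\<close>
  define c where "c A = (SOME z. \<exists>a\<in>A. \<exists>b\<in>A. a \<noteq> b \<and> z = y a b)" for A
  have c: "c (C l) = y i j" if "i \<in> C l" "j \<in> C l" "i \<noteq> j" "l \<in> {1..d}" for i j l
  proof -
    have "\<exists>z. \<exists>a\<in>C l. \<exists>b\<in>C l. a \<noteq> b \<and> z = y a b" using that by blast
    from someI_ex[OF this] obtain a b where "a \<in> C l" "b \<in> C l" "a \<noteq> b" "c (C l) = y a b"
      unfolding c_def by blast
    then show ?thesis using const[of i l j a b] that by simp
  qed
  have "coordinates d \<phi> p
      = (\<Sum>A\<in>?F. if p \<in> index_pairs d \<and> fst p \<in> A \<and> snd p \<in> A then c A else 0)" for p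
  proof (cases "p \<in> index_pairs d")
    case True
    then obtain i j where p: "p = (i, j)" and ij: "i \<in> {1..d}" "j \<in> {1..d}" "i \<noteq> j"
      by (auto simp: index_pairs_def)
    \<comment> \<open>The only block containing \<open>i\<close> is its own class, so the sum over
      the blocks collapses to one term.\<close>
    have uniq: "A = C i" if "A \<in> ?F" "i \<in> A" for A
    proof -
      obtain l where l: "l \<in> {1..d}" "A = C l" using \<open>A \<in> ?F\<close> by blast
      then show ?thesis using C_eq[OF l(1) ij(1)] \<open>i \<in> A\<close> by (simp add: C_def)
    qed
    have "(if i \<in> A \<and> j \<in> A then c A else 0) = 0" if "A \<in> ?F - {C i}" for A
      using that uniq[of A] by (cases "i \<in> A") simp_all
    then have "(\<Sum>A\<in>?F. if i \<in> A \<and> j \<in> A then c A else 0)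
        = (\<Sum>A\<in>{C i}. if i \<in> A \<and> j \<in> A then c A else 0)"
      using ij(1) by (intro sum.mono_neutral_right ballI) simp_all
    also have "\<dots> = (if j \<in> C i then c (C i) else 0)"
      using ij by (simp add: C_def)
    also have "\<dots> = y i j"
      using ij c[of i i j] by (auto simp: C_def)
    finally show ?thesis using True p by (simp add: coordinates_def y_def)
  qed (simp add: coordinates_def)
  then have "coordinates d \<phi> \<in> span_k (e_set d ` ?F)"
    unfolding mem_span_disjoint_family[OF F] by blast
  with F show ?thesis by (rule that)
qed

section \<open>Every vector in such a span is a point\<close>

lemma span_in_coordinates:
  fixes x :: "nat \<times> nat \<Rightarrow> 'k::alg_closed_field"
  assumes F: "F \<in> disjoint_families d" and x: "x \<in> span_k (e_set d ` F)"
  shows "x \<in> coordinates d ` k_points (ring_of_components d)"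
proof -
  let ?G = "sym_group d"
  obtain c where c: "\<And>p. x p
      = (\<Sum>A\<in>F. if p \<in> index_pairs d \<and> fst p \<in> A \<and> snd p \<in> A then c A else 0)"
    using x unfolding mem_span_disjoint_family[OF F] by blast
  \<comment> \<open>A pair \<open>[transpose i j, transpose i j]\<close> contributes its weight
    twice, so the weight must be a square root of the wanted coordinate. It exists because the field
    is algebraically closed.\<close>
  have "\<exists>r. \<forall>A. r A ^ 2 = c A"
    using nth_root_exists[of 2] by (intro choice) auto
  then obtain r where r: "\<And>A. r A ^ 2 = c A" by blast
  have disj: "A = B" if "A \<in> F" "B \<in> F" "z \<in> A" "z \<in> B" for A B z
    using F that unfolding disjoint_families_def pairwise_def disjnt_def by blast
  have finF: "finite F"
    using F finite_subset[of F "Pow {1..d}"] by (simp add: disjoint_families_def)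
  \<comment> \<open>The weight is defined through the set of moved points, hence on the whole group,
    as the conjugation hypothesis of \<open>k_point_of_weight\<close> requires.\<close>
  define \<mu> where "\<mu> g = (\<Sum>A\<in>F. if {z. g z \<noteq> z} \<subseteq> A then r A else 0)" for g :: "nat \<Rightarrow> nat"
  have conj: "\<mu> (g \<otimes>\<^bsub>?G\<^esub> h \<otimes>\<^bsub>?G\<^esub> inv\<^bsub>?G\<^esub> g) * \<mu> g = \<mu> h * \<mu> g"
    if g: "g \<in> carrier ?G" and h: "h \<in> carrier ?G" for g h
  proof (cases "\<exists>A\<in>F. {z. g z \<noteq> z} \<subseteq> A")
    \<comment> \<open>If no block contains all points moved by \<open>g\<close>, then both sides
      vanish through the factor \<open>\<mu> g\<close>.\<close>
    case False
    then have "\<mu> g = 0" by (auto simp: \<mu>_def intro!: sum.neutral)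
    then show ?thesis by simp
  next
    case True
    then obtain A where A: "A \<in> F" "{z. g z \<noteq> z} \<subseteq> A" by blast
    have bij: "bij g" using g by (simp add: sym_group_carrier permutes_bij)
    have moved: "g z \<in> {z. g z \<noteq> z}" if "g z \<noteq> z" for z
      using that bij by (auto dest: bij_is_inj injD)
    \<comment> \<open>A point moved by \<open>g\<close> and its image both lie in \<open>A\<close>,
      and any other block is disjoint from \<open>A\<close>. Hence \<open>g\<close> preserves every
      block.\<close>
    have iff: "g z \<in> B \<longleftrightarrow> z \<in> B" if "B \<in> F" for B z
    proof (cases "g z = z")
      case False
      then have "z \<in> A" "g z \<in> A" using A(2) moved by blast+
      then show ?thesis using disj[OF A(1) that] by blast
    qed simp
    \<comment> \<open>Conjugation by \<open>g\<close> carries the moved points of \<open>h\<close>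
      to their images under \<open>g\<close>. As \<open>g\<close> preserves blocks, the same blocks
      contain them, and the weight is unchanged.\<close>
    have "{z. (g \<circ> h \<circ> inv' g) z \<noteq> z} = g ` {z. h z \<noteq> z}"
    proof -
      have "g (h (inv' g z)) = z \<longleftrightarrow> h (inv' g z) = inv' g z" for z
        using bij by (metis bij_inv_eq_iff)
      then have "{z. (g \<circ> h \<circ> inv' g) z \<noteq> z} = {z. inv' g z \<in> {z. h z \<noteq> z}}" by simp
      also have "\<dots> = g ` {z. h z \<noteq> z}"
        using bij by (simp add: bij_image_Collect_eq)
      finally show ?thesis .
    qed
    then have "{z. (g \<circ> h \<circ> inv' g) z \<noteq> z} \<subseteq> B \<longleftrightarrow> {z. h z \<noteq> z} \<subseteq> B" if "B \<in> F" for B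
      using iff[OF that] by auto
    then have "\<mu> (g \<circ> h \<circ> inv' g) = \<mu> h" unfolding \<mu>_def by (intro sum.cong) auto
    then show ?thesis using g by (simp add: sym_group_mult)
  qed
  obtain \<phi> where \<phi>: "\<phi> \<in> k_points (monoid_algebra (Comp ?G (transpositions d)))"
    "\<And>t. set t \<subseteq> transpositions d \<Longrightarrow> tuple_prod ?G t = \<one>\<^bsub>?G\<^esub>
      \<Longrightarrow> \<phi> (monomial (braid_orbit ?G t)) = prod_list (map \<mu> t)"
    using k_point_of_weight[of ?G "transpositions d" \<mu>, OF sym_group_is_group transpositions_subset conj]
    by blast
  have "coordinates d \<phi> p = x p" for p
  proof (cases "p \<in> index_pairs d")
    case False
    then show ?thesis by (simp add: coordinates_def c)
  next
    case True
    then obtain i j where p: "p = (i, j)" and ij: "i \<in> {1..d}" "j \<in> {1..d}" "i \<noteq> j"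
      by (auto simp: index_pairs_def)
    have "{z. transpose i j z \<noteq> z} = {i, j}" using ij by (auto simp: transpose_def)
    then have \<mu>: "\<mu> (transpose i j) = (\<Sum>A\<in>F. if i \<in> A \<and> j \<in> A then r A else 0)"
      by (simp add: \<mu>_def)
    have "coordinates d \<phi> p = \<mu> (transpose i j) ^ 2"
      using True \<phi>(2)[of "[transpose i j, transpose i j]"] transposition_in_transpositions[OF ij]
        tuple_prod_transposition_pair[of d i j]
      by (simp add: coordinates_def p pair_component_def power2_eq_square)
    \<comment> \<open>At most one block contains both \<open>i\<close> and \<open>j\<close>, so the
      sum has at most one nonzero term and can be squared termwise.\<close>
    also have "\<dots> = (\<Sum>A\<in>F. if i \<in> A \<and> j \<in> A then c A else 0)"
    proof (cases "\<exists>A\<in>F. i \<in> A \<and> j \<in> A")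
      case False
      then have "(\<Sum>A\<in>F. if i \<in> A \<and> j \<in> A then f A else 0) = 0" for f :: "nat set \<Rightarrow> 'k"
        by (intro sum.neutral ballI) auto
      then show ?thesis unfolding \<mu> by simp
    next
      case True
      then obtain A where A: "A \<in> F" "i \<in> A" "j \<in> A" by blast
      have "(\<Sum>B\<in>F. if i \<in> B \<and> j \<in> B then f B else 0) = f A" for f :: "nat set \<Rightarrow> 'k"
      proof -
        have "(\<Sum>B\<in>F. if i \<in> B \<and> j \<in> B then f B else 0) = (\<Sum>B\<in>F. if B = A then f B else 0)"
          using A disj by (intro sum.cong) auto
        then show ?thesis using A finF by simp
      qed
      then show ?thesis unfolding \<mu> by (simp add: r)
    qed
    also have "\<dots> = x p" using True by (simp add: c p)
    finally show ?thesis .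
  qed
  then show ?thesis
    using \<phi>(1) unfolding ring_of_components_def by (intro image_eqI[of _ _ \<phi>]) auto
qed

text \<open>There are finitely many disjoint families, so each one extends to a maximal one, and
  spans grow with the family. A maximal family is a partition of \<open>{1..d}\<close> together with
  the empty set, which contributes only the zero vector.\<close>

lemma Union_maximal_disjoint_families:
  "(\<Union>F\<in>maximal_disjoint_families d. span_k (e_set d ` F)) =
    (\<Union>F\<in>disjoint_families d. span_k (e_set d ` F) :: (nat \<times> nat \<Rightarrow> 'k::field) set)"
proof
  interpret V: Modules.module "\<lambda>(a::'k) f (x::nat \<times> nat). a * f x" by (rule module_fun)
  show "(\<Union>F\<in>maximal_disjoint_families d. span_k (e_set d ` F)) \<subseteq>
      (\<Union>F\<in>disjoint_families d. span_k (e_set d ` F) :: (nat \<times> nat \<Rightarrow> 'k) set)"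
    by (auto simp: maximal_disjoint_families_def)
  show "(\<Union>F\<in>disjoint_families d. span_k (e_set d ` F)) \<subseteq>
      (\<Union>F\<in>maximal_disjoint_families d. span_k (e_set d ` F) :: (nat \<times> nat \<Rightarrow> 'k) set)"
  proof (rule UN_least)
    fix F assume "F \<in> disjoint_families d"
    then obtain F' where F': "F' \<in> disjoint_families d" "F \<subseteq> F'"
      "\<forall>F''\<in>disjoint_families d. F' \<subseteq> F'' \<longrightarrow> F' = F''"
      using finite_has_maximal2[OF finite_disjoint_families] by metis
    then have "F' \<in> maximal_disjoint_families d" by (auto simp: maximal_disjoint_families_def)
    moreover have "span_k (e_set d ` F) \<subseteq> (span_k (e_set d ` F') :: (nat \<times> nat \<Rightarrow> 'k) set)"
      using F'(2) by (intro V.span_mono image_mono)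
    ultimately show "span_k (e_set d ` F) \<subseteq>
        (\<Union>F\<in>maximal_disjoint_families d. span_k (e_set d ` F) :: (nat \<times> nat \<Rightarrow> 'k) set)"
      by blast
  qed
qed

theorem theorem6p21:
  fixes d :: nat
  assumes "d \<ge> 2"
    and "\<not> CHAR('k::alg_closed_field) dvd fact d"
  shows "coordinates d ` k_points (ring_of_components d)
           = (\<Union>F\<in>disjoint_families d. span_k (e_set d ` F) :: (nat \<times> nat \<Rightarrow> 'k) set)
       \<and> coordinates d ` k_points (ring_of_components d)
           = (\<Union>F\<in>maximal_disjoint_families d. span_k (e_set d ` F) :: (nat \<times> nat \<Rightarrow> 'k) set)"
proof -
  have "coordinates d ` k_points (ring_of_components d)
      = (\<Union>F\<in>disjoint_families d. span_k (e_set d ` F) :: (nat \<times> nat \<Rightarrow> 'k) set)"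
  proof (intro subset_antisym subsetI)
    fix x :: "nat \<times> nat \<Rightarrow> 'k"
    assume "x \<in> coordinates d ` k_points (ring_of_components d)"
    then show "x \<in> (\<Union>F\<in>disjoint_families d. span_k (e_set d ` F))"
      by (elim imageE) (metis UN_iff coordinates_in_span)
  next
    fix x :: "nat \<times> nat \<Rightarrow> 'k"
    assume "x \<in> (\<Union>F\<in>disjoint_families d. span_k (e_set d ` F))"
    then show "x \<in> coordinates d ` k_points (ring_of_components d)"
      by (elim UN_E) (rule span_in_coordinates)
  qed
  then show ?thesis by (simp only: Union_maximal_disjoint_families)
qed

end
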